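(* Each of the following metric spaces $X$ is $1$-complemented in every ultra-completion of $X$: (i) proper metric spaces; (ii) Hadamard spaces; (iii) injective metric spaces; (iv) dual Banach spaces; (v) Banach spaces which are $1$-complemented in some dual Banach space.
   Context: Ultra-completions. A non-principal ultrafilter $\omega$ on $\mathbb{N}$ is a finitely additive probability measure defined on all subsets of $\mathbb{N}$ with values in $\{0,1\}$ and vanishing on finite sets. For a bounded real sequence $(a_m)$, $\lim_\omega a_m$ is the unique $a\in\mathbb{R}$ with $\omega(\{m: a_m\in U\})=1$ for every open $U\ni a$. For a metric space $(X,d)$, the ultra-completion $X_\omega$ is the set of equivalence classes $[(x_m)]$ of sequences in $X$ with $\sup_m d(x_1,x_m)<\infty$, where $(x_m)\sim(x_m')$ iff $\lim_\omega d(x_m,x'_m)=0$, with metric $d_\omega([(x_m)],[(x_m')])=\lim_\omega d(x_m,x_m')$. The map $\iota\colon X\to X_\omega$, $\iota(x)=[(x)]$ (constant sequence), is an isometric embedding, via which $X$ is viewed as a subset of $X_\omega$. That $X$ is $1$-complemented in every ultra-completion of $X$ means: for every non-principal ultrafilter $\omega$ on $\mathbb{N}$ there is a $1$-Lipschitz retraction $X_\omega\to X$, i.e. a $1$-Lipschitz map $P\colon X_\omega\to X$ with $P\circ\iota=\mathrm{id}_X$. A metric space $X$ is $1$-complemented in a metric space $Y$ if $X$ embeds isometrically into $Y$ and there is a $1$-Lipschitz retraction from $Y$ to (the image of) $X$. A metric space is proper if all its closed bounded subsets are compact. A Hadamard space is a complete $\mathrm{CAT}(0)$ metric space. A metric space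 $X$ is injective if it is $1$-complemented in every metric space into which it embeds isometrically (i.e. for every isometric embedding $j\colon X\to Y$ there is a $1$-Lipschitz $P\colon Y\to X$ with $P\circ j=\mathrm{id}_X$). A dual Banach space is a Banach space that is (isometrically) the dual of a Banach space. *)

theory Defs
  imports "HOL-Analysis.Analysis"
begin

section \<open>Ultra-completions\<close>

definition nonprincipal_ultrafilter :: "(nat set \<Rightarrow> real) \<Rightarrow> bool" where
  "nonprincipal_ultrafilter \<omega> \<longleftrightarrow>
     range \<omega> \<subseteq> {0, 1} \<and> \<omega> UNIV = 1 \<and>
     (\<forall>A B. A \<inter> B = {} \<longrightarrow> \<omega> (A \<union> B) = \<omega> A + \<omega> B) \<and>
     (\<forall>A. finite A \<longrightarrow> \<omega> A = 0)"

definition ultra_lim :: "(nat set \<Rightarrow> real) \<Rightarrow> (nat \<Rightarrow> real) \<Rightarrow> real" where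
  "ultra_lim \<omega> a = (THE l. \<forall>U. open U \<and> l \<in> U \<longrightarrow> \<omega> {m. a m \<in> U} = 1)"

text \<open>
  A metric space is given by a carrier \<open>M\<close> and a distance function \<open>d\<close>, since the
  ultra-completion depends on the ultrafilter and is therefore not a type.
\<close>

definition ultra_seqs :: "'a set \<Rightarrow> ('a \<Rightarrow> 'a \<Rightarrow> real) \<Rightarrow> (nat \<Rightarrow> 'a) set" where
  "ultra_seqs M d = {x. range x \<subseteq> M \<and> bdd_above (range (\<lambda>m. d (x 0) (x m)))}"

definition ultra_rel ::
  "(nat set \<Rightarrow> real) \<Rightarrow> 'a set \<Rightarrow> ('a \<Rightarrow> 'a \<Rightarrow> real) \<Rightarrow> ((nat \<Rightarrow> 'a) \<times> (nat \<Rightarrow> 'a)) set" where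
  "ultra_rel \<omega> M d =
     {(x, y). x \<in> ultra_seqs M d \<and> y \<in> ultra_seqs M d \<and> ultra_lim \<omega> (\<lambda>m. d (x m) (y m)) = 0}"

definition ultra_completion ::
  "(nat set \<Rightarrow> real) \<Rightarrow> 'a set \<Rightarrow> ('a \<Rightarrow> 'a \<Rightarrow> real) \<Rightarrow> (nat \<Rightarrow> 'a) set set" where
  "ultra_completion \<omega> M d = ultra_seqs M d // ultra_rel \<omega> M d"

text \<open>
  On \<^term>\<open>ultra_completion \<omega> M d\<close> the value does not depend on the representatives;
  nothing is claimed about \<open>ultra_dist\<close> on other sets of sequences.
\<close>

definition ultra_dist ::
  "(nat set \<Rightarrow> real) \<Rightarrow> ('a \<Rightarrow> 'a \<Rightarrow> real) \<Rightarrow> (nat \<Rightarrow> 'a) set \<Rightarrow> (nat \<Rightarrow> 'a) set \<Rightarrow> real" where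
  "ultra_dist \<omega> d A B = (THE r. \<forall>x\<in>A. \<forall>y\<in>B. r = ultra_lim \<omega> (\<lambda>m. d (x m) (y m)))"

definition ultra_incl ::
  "(nat set \<Rightarrow> real) \<Rightarrow> 'a set \<Rightarrow> ('a \<Rightarrow> 'a \<Rightarrow> real) \<Rightarrow> 'a \<Rightarrow> (nat \<Rightarrow> 'a) set" where
  "ultra_incl \<omega> M d x = ultra_rel \<omega> M d `` {\<lambda>_. x}"


section \<open>1-complemented metric spaces\<close>

definition isometric_embedding ::
  "'a set \<Rightarrow> ('a \<Rightarrow> 'a \<Rightarrow> real) \<Rightarrow> 'b set \<Rightarrow> ('b \<Rightarrow> 'b \<Rightarrow> real) \<Rightarrow> ('a \<Rightarrow> 'b) \<Rightarrow> bool" where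
  "isometric_embedding M d N e j \<longleftrightarrow>
     j \<in> M \<rightarrow> N \<and> (\<forall>x\<in>M. \<forall>y\<in>M. e (j x) (j y) = d x y)"

definition one_lipschitz ::
  "'b set \<Rightarrow> ('b \<Rightarrow> 'b \<Rightarrow> real) \<Rightarrow> 'a set \<Rightarrow> ('a \<Rightarrow> 'a \<Rightarrow> real) \<Rightarrow> ('b \<Rightarrow> 'a) \<Rightarrow> bool" where
  "one_lipschitz N e M d P \<longleftrightarrow>
     P \<in> N \<rightarrow> M \<and> (\<forall>x\<in>N. \<forall>y\<in>N. d (P x) (P y) \<le> e x y)"

definition one_complemented ::
  "'a set \<Rightarrow> ('a \<Rightarrow> 'a \<Rightarrow> real) \<Rightarrow> 'b set \<Rightarrow> ('b \<Rightarrow> 'b \<Rightarrow> real) \<Rightarrow> bool" where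
  "one_complemented M d N e \<longleftrightarrow>
     (\<exists>j P. isometric_embedding M d N e j \<and> one_lipschitz N e M d P \<and> (\<forall>x\<in>M. P (j x) = x))"

definition one_complemented_in_ultra_completions ::
  "'a set \<Rightarrow> ('a \<Rightarrow> 'a \<Rightarrow> real) \<Rightarrow> bool" where
  "one_complemented_in_ultra_completions M d \<longleftrightarrow>
     (\<forall>\<omega>. nonprincipal_ultrafilter \<omega> \<longrightarrow>
        (\<exists>P. one_lipschitz (ultra_completion \<omega> M d) (ultra_dist \<omega> d) M d P \<and>
             (\<forall>x\<in>M. P (ultra_incl \<omega> M d x) = x)))"


section \<open>Proper and Hadamard spaces\<close>

definition proper_metric_space :: "'a set \<Rightarrow> ('a \<Rightarrow> 'a \<Rightarrow> real) \<Rightarrow> bool" where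
  "proper_metric_space M d \<longleftrightarrow>
     Metric_space M d \<and>
     (\<forall>S. closedin (Metric_space.mtopology M d) S \<and> Metric_space.mbounded M d S \<longrightarrow>
          compactin (Metric_space.mtopology M d) S)"

definition geodesic ::
  "'a set \<Rightarrow> ('a \<Rightarrow> 'a \<Rightarrow> real) \<Rightarrow> 'a \<Rightarrow> 'a \<Rightarrow> (real \<Rightarrow> 'a) \<Rightarrow> bool" where
  "geodesic M d x y c \<longleftrightarrow>
     c \<in> {0..d x y} \<rightarrow> M \<and> c 0 = x \<and> c (d x y) = y \<and>
     (\<forall>s\<in>{0..d x y}. \<forall>t\<in>{0..d x y}. d (c s) (c t) = \<bar>s - t\<bar>)"

text \<open>
  Any two sides of a geodesic triangle share a vertex \<open>p\<close>, so comparing points on the two sides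
  \<open>[p,q]\<close> and \<open>[p,r]\<close>, for all triples \<open>p, q, r\<close>, compares all pairs of points on different
  sides. The points \<open>x'\<close> and \<open>y'\<close> are the comparison points of \<open>c s\<close> and \<open>c' t\<close>.
\<close>

definition CAT0_space :: "'a set \<Rightarrow> ('a \<Rightarrow> 'a \<Rightarrow> real) \<Rightarrow> bool" where
  "CAT0_space M d \<longleftrightarrow>
     Metric_space M d \<and>
     (\<forall>x\<in>M. \<forall>y\<in>M. \<exists>c. geodesic M d x y c) \<and>
     (\<forall>p\<in>M. \<forall>q\<in>M. \<forall>r\<in>M. \<forall>c c'. geodesic M d p q c \<longrightarrow> geodesic M d p r c' \<longrightarrow>
        (\<forall>(p'::real^2) q' r'.
           dist p' q' = d p q \<and> dist p' r' = d p r \<and> dist q' r' = d q r \<longrightarrow>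
           (\<forall>s\<in>{0..d p q}. \<forall>t\<in>{0..d p r}.
              \<forall>x'\<in>closed_segment p' q'. \<forall>y'\<in>closed_segment p' r'.
                dist p' x' = s \<and> dist p' y' = t \<longrightarrow> d (c s) (c' t) \<le> dist x' y')))"

definition Hadamard_space :: "'a set \<Rightarrow> ('a \<Rightarrow> 'a \<Rightarrow> real) \<Rightarrow> bool" where
  "Hadamard_space M d \<longleftrightarrow> CAT0_space M d \<and> Metric_space.mcomplete M d"


section \<open>Injective metric spaces\<close>

definition injective_wrt :: "'b itself \<Rightarrow> 'a set \<Rightarrow> ('a \<Rightarrow> 'a \<Rightarrow> real) \<Rightarrow> bool" where
  "injective_wrt (_ :: 'b itself) M d \<longleftrightarrow>
     Metric_space M d \<and>
     (\<forall>(N :: 'b set) e j. Metric_space N e \<and> isometric_embedding M d N e j \<longrightarrow>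
        (\<exists>P. one_lipschitz N e M d P \<and> (\<forall>x\<in>M. P (j x) = x)))"

text \<open>
  HOL cannot quantify over all types inside a formula, so the ambient spaces range over the
  metric spaces with points in one type. It contains all ultra-completions of \<open>M\<close>, and
  \<open>injective_metric_space_wrt\<close> below shows that nothing is lost: the definition implies
  injectivity with respect to ambient spaces of every type.
\<close>

definition injective_metric_space :: "'a set \<Rightarrow> ('a \<Rightarrow> 'a \<Rightarrow> real) \<Rightarrow> bool" where
  "injective_metric_space M d \<longleftrightarrow> injective_wrt TYPE((nat \<Rightarrow> 'a) set) M d"

lemma injective_imp_one_point_extension:
  fixes M :: "'a set" and d :: "'a \<Rightarrow> 'a \<Rightarrow> real" and f :: "'a \<Rightarrow> real"
  assumes inj: "injective_metric_space M d"
    and lip: "\<And>x y. x \<in> M \<Longrightarrow> y \<in> M \<Longrightarrow> f x \<le> d x y + f y"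
    and tri: "\<And>x y. x \<in> M \<Longrightarrow> y \<in> M \<Longrightarrow> d x y \<le> f x + f y"
  shows "\<exists>p\<in>M. \<forall>x\<in>M. d p x \<le> f x"
proof (cases "\<exists>p\<in>M. f p = 0")
  case True
  then show ?thesis using tri by force
next
  case False
  interpret Metric_space M d
    using inj by (simp add: injective_metric_space_def injective_wrt_def)
  have fpos: "f x > 0" if "x \<in> M" for x
    using tri[OF that that] False that by force
  define j :: "'a \<Rightarrow> (nat \<Rightarrow> 'a) set" where "j x = {\<lambda>_. x}" for x
  define k :: "(nat \<Rightarrow> 'a) set \<Rightarrow> 'a" where "k A = (SOME x. A = j x)" for A
  have j_inj: "j x = j y \<longleftrightarrow> x = y" for x y
    by (auto simp: j_def fun_eq_iff)
  have kj[simp]: "k (j x) = x" for x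
    by (simp add: k_def j_inj)
  have j_ne[simp]: "j x \<noteq> {}" "{} \<noteq> j x" for x
    by (auto simp: j_def)
  define e where "e A B =
      (if A = {} then (if B = {} then 0 else \<bar>f (k B)\<bar>)
       else if B = {} then \<bar>f (k A)\<bar> else d (k A) (k B))" for A B
  define N where "N = insert {} (j ` M)"
  have "Metric_space N e"
  proof
    show "0 \<le> e A B" for A B by (simp add: e_def)
    show "e A B = e B A" for A B by (simp add: e_def commute)
    show "e A B = 0 \<longleftrightarrow> A = B" if "A \<in> N" "B \<in> N" for A B
      using that fpos by (fastforce simp: N_def e_def j_inj)
    show "e A C \<le> e A B + e B C" if "A \<in> N" "B \<in> N" "C \<in> N" for A B C
    proof -
      have abs: "\<bar>f x\<bar> = f x" if "x \<in> M" for x using fpos[OF that] by simp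
      have lip': "f x \<le> f y + d y x" if "x \<in> M" "y \<in> M" for x y
        using lip[OF that] by (simp add: commute)
      show ?thesis
        using that fpos lip lip' tri triangle
        by (auto simp: N_def e_def abs)
    qed
  qed
  moreover have "isometric_embedding M d N e j"
    by (auto simp: isometric_embedding_def N_def e_def)
  ultimately obtain P where P: "one_lipschitz N e M d P" "\<And>x. x \<in> M \<Longrightarrow> P (j x) = x"
    using inj unfolding injective_metric_space_def injective_wrt_def by blast
  have "P {} \<in> M" and "\<forall>x\<in>M. d (P {}) (P (j x)) \<le> e {} (j x)"
    using P(1) by (auto simp: one_lipschitz_def N_def)
  then have "\<forall>x\<in>M. d (P {}) x \<le> f x"
    using P(2) fpos by (force simp: e_def)
  with \<open>P {} \<in> M\<close> show ?thesis by blast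
qed

lemma injective_metric_space_wrt:
  fixes M :: "'a set" and d :: "'a \<Rightarrow> 'a \<Rightarrow> real"
  assumes inj: "injective_metric_space M d"
  shows "injective_wrt TYPE('b) M d"
proof -
  interpret M: Metric_space M d
    using inj by (simp add: injective_metric_space_def injective_wrt_def)
  have nonempty: "M \<noteq> {}"
    using injective_imp_one_point_extension[OF inj, of "\<lambda>_. 0"] by auto
  have "\<exists>P. one_lipschitz N e M d P \<and> (\<forall>x\<in>M. P (j x) = x)"
    if N: "Metric_space N e" and j: "isometric_embedding M d N e j"
    for N :: "'b set" and e j
  proof -
    interpret N: Metric_space N e by fact
    define G0 where "G0 = (\<lambda>x. (j x, x)) ` M"
    define \<G> where "\<G> = {G. G0 \<subseteq> G \<and> G \<subseteq> N \<times> M \<and>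
        (\<forall>(s, p)\<in>G. \<forall>(t, q)\<in>G. d p q \<le> e s t)}"
    have "G0 \<in> \<G>"
      using j by (auto simp: \<G>_def G0_def isometric_embedding_def)
    moreover have "\<Union>\<C> \<in> \<G>" if C: "\<C> \<noteq> {}" "subset.chain \<G> \<C>" for \<C>
    proof -
      have sub: "\<C> \<subseteq> \<G>" and ch: "\<And>G H. G \<in> \<C> \<Longrightarrow> H \<in> \<C> \<Longrightarrow> G \<subseteq> H \<or> H \<subseteq> G"
        using C(2) by (auto simp: subset_chain_def)
      have "d p q \<le> e s t" if st: "(s, p) \<in> \<Union>\<C>" "(t, q) \<in> \<Union>\<C>" for s p t q
      proof -
        obtain A B where AB: "A \<in> \<C>" "B \<in> \<C>" "(s, p) \<in> A" "(t, q) \<in> B"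
          using st by blast
        then obtain G where "G \<in> \<C>" "(s, p) \<in> G" "(t, q) \<in> G"
          using ch[OF AB(1,2)] by blast
        then show ?thesis using sub by (fastforce simp: \<G>_def)
      qed
      moreover have "G0 \<subseteq> H" "H \<subseteq> N \<times> M" if "H \<in> \<C>" for H
        using sub that by (auto simp: \<G>_def)
      then have "G0 \<subseteq> \<Union>\<C>" "\<Union>\<C> \<subseteq> N \<times> M"
        using C(1) by blast+
      ultimately show ?thesis unfolding \<G>_def by blast
    qed
    ultimately obtain G where G: "G \<in> \<G>" and max: "\<And>H. H \<in> \<G> \<Longrightarrow> G \<subseteq> H \<Longrightarrow> H = G"
      using subset_Zorn_nonempty[of \<G>] by blast
    have GN: "s \<in> N" "p \<in> M" if "(s, p) \<in> G" for s p
      using G that by (auto simp: \<G>_def)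
    have G0: "(j x, x) \<in> G" if "x \<in> M" for x
      using G that by (auto simp: \<G>_def G0_def)
    have Glip: "d p q \<le> e s t" if "(s, p) \<in> G" "(t, q) \<in> G" for s p t q
      using G that by (fastforce simp: \<G>_def)
    have "\<exists>p. (y, p) \<in> G" if y: "y \<in> N" for y
    proof -
      define f where "f x = (INF (s, p)\<in>G. d x p + e s y)" for x
      have ne: "G \<noteq> {}" using nonempty G0 by blast
      have bdd: "bdd_below ((\<lambda>(s, p). d x p + e s y) ` G)" for x
        by (rule bdd_belowI[of _ 0]) auto
      have f_le: "f x \<le> d x p + e s y" if "(s, p) \<in> G" for x s p
        unfolding f_def using cINF_lower[OF bdd that] by simp
      have f_ge: "c \<le> f x" if "\<And>s p. (s, p) \<in> G \<Longrightarrow> c \<le> d x p + e s y" for c x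
        unfolding f_def using ne that by (intro cINF_greatest) auto
      have "f x \<le> d x z + f z" if "x \<in> M" "z \<in> M" for x z
      proof -
        have "f x - d x z \<le> f z"
        proof (rule f_ge)
          fix s p assume sp: "(s, p) \<in> G"
          show "f x - d x z \<le> d z p + e s y"
            using f_le[OF sp, of x] M.triangle[OF that GN(2)[OF sp]] by linarith
        qed
        then show ?thesis by simp
      qed
      moreover have "d x z \<le> f x + f z" if "x \<in> M" "z \<in> M" for x z
      proof -
        have "d x z - f z \<le> f x"
        proof (rule f_ge)
          fix s p assume sp: "(s, p) \<in> G"
          have "d x z - (d x p + e s y) \<le> f z"
          proof (rule f_ge)
            fix t q assume tq: "(t, q) \<in> G"
            have "d x z \<le> d x p + d p z" "d p z \<le> d p q + d q z"
              using M.triangle GN[OF sp] GN[OF tq] that by blast+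
            moreover have "d p q \<le> e s y + e t y"
              using Glip[OF sp tq] N.triangle[OF GN(1)[OF sp] y GN(1)[OF tq]] N.commute[of y t]
              by linarith
            ultimately show "d x z - (d x p + e s y) \<le> d z q + e t y"
              using M.commute[of q z] by linarith
          qed
          then show "d x z - f z \<le> d x p + e s y" by linarith
        qed
        then show ?thesis by linarith
      qed
      ultimately obtain p where p: "p \<in> M" "\<And>x. x \<in> M \<Longrightarrow> d p x \<le> f x"
        using injective_imp_one_point_extension[OF inj] by metis
      have new: "d p q \<le> e y t" "d q p \<le> e t y" if "(t, q) \<in> G" for t q
      proof -
        have "d p q \<le> e t y"
          using p(2)[OF GN(2)[OF that]] f_le[OF that, of q] GN(2)[OF that] by simp
        then show "d p q \<le> e y t" "d q p \<le> e t y"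
          by (simp_all add: M.commute N.commute)
      qed
      have "insert (y, p) G \<in> \<G>"
        using G new p(1) y unfolding \<G>_def by auto
      then show ?thesis using max by blast
    qed
    then obtain P where P: "\<And>y. y \<in> N \<Longrightarrow> (y, P y) \<in> G" by metis
    have "one_lipschitz N e M d P"
      using P GN(2) Glip by (auto simp: one_lipschitz_def)
    moreover have "P (j x) = x" if "x \<in> M" for x
    proof -
      have jx: "j x \<in> N" using j that by (auto simp: isometric_embedding_def)
      have "d (P (j x)) x \<le> 0" using Glip[OF P[OF jx] G0[OF that]] jx by simp
      then show ?thesis
        using M.nonneg[of "P (j x)" x] M.zero GN(2)[OF P[OF jx]] that by force
    qed
    ultimately show ?thesis by blast
  qed
  then show ?thesis
    using M.Metric_space_axioms by (auto simp: injective_wrt_def)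
qed


section \<open>Dual Banach spaces\<close>

text \<open>
  A dual Banach space is a Banach space \<open>'x\<close> with \<open>isometric_dual TYPE('x) TYPE('z)\<close> for some
  Banach space \<open>'z\<close>; being a type, the predual is a parameter here, and a free type variable in
  the hypothesis of a theorem. Scalars are real. This covers complex scalars, since \<open>f \<mapsto> Re f\<close>
  is a real-linear isometry of the complex dual onto the dual of the underlying real space.
\<close>

definition isometric_dual :: "'x::banach itself \<Rightarrow> 'z::banach itself \<Rightarrow> bool" where
  "isometric_dual (_ :: 'x itself) (_ :: 'z itself) \<longleftrightarrow>
     (\<exists>\<phi> :: 'x \<Rightarrow> ('z \<Rightarrow>\<^sub>L real). linear \<phi> \<and> surj \<phi> \<and> (\<forall>x. norm (\<phi> x) = norm x))"

end

theory Submission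
  imports Defs
begin

text \<open>
  A retraction of the ultra-completion assigns to every bounded sequence \<open>x\<close> a point \<open>Q x\<close> with
  \<open>d (Q x) (Q y) \<le> lim d (x m) (y m)\<close> along the ultrafilter. In a proper space, \<open>Q x\<close> is the limit
  of \<open>x\<close> along the ultrafilter; in a dual Banach space it is the weak-star limit. In a Hadamard
  space, \<open>Q x\<close> is the barycenter of \<open>x\<close>, the unique minimizer of \<open>p \<mapsto> lim (d p (x m))\<^sup>2\<close>; the variance
  inequality at the barycenters of \<open>x\<close> and \<open>y\<close>, added up and compared with the quadrilateral
  inequality for \<open>x m\<close>, \<open>y m\<close> and the barycenters, shows that \<open>Q\<close> is 1-Lipschitz. For an injective
  space one only needs that the ultra-completion is a metric space.
\<close>

section \<open>Limits along an ultrafilter\<close>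

locale ultrafilter_nat =
  fixes \<omega> :: "nat set \<Rightarrow> real"
  assumes ultrafilter: "nonprincipal_ultrafilter \<omega>"
begin

section \<open>Two-valued finitely additive measures on the natural numbers\<close>

lemma cases01: "\<omega> A = 0 \<or> \<omega> A = 1"
  using ultrafilter by (auto simp: nonprincipal_ultrafilter_def)

lemma additive: "A \<inter> B = {} \<Longrightarrow> \<omega> (A \<union> B) = \<omega> A + \<omega> B"
  using ultrafilter by (auto simp: nonprincipal_ultrafilter_def)

lemma measure_UNIV: "\<omega> UNIV = 1" and measure_empty: "\<omega> {} = 0"
  using ultrafilter by (auto simp: nonprincipal_ultrafilter_def)

lemma measure_mono:
  assumes "A \<subseteq> B" shows "\<omega> A \<le> \<omega> B"
proof -
  have "\<omega> B = \<omega> A + \<omega> (B - A)"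
    using additive[of A "B - A"] assms by (simp add: Un_absorb1)
  then show ?thesis using cases01[of "B - A"] by auto
qed

lemma measure_Compl: "\<omega> (- A) = 1 - \<omega> A"
  using additive[of A "- A"] measure_UNIV by simp

lemma measure_Int:
  assumes "\<omega> A = 1" "\<omega> B = 1" shows "\<omega> (A \<inter> B) = 1"
proof -
  have "\<omega> (A - B) \<le> \<omega> (- B)" by (rule measure_mono) auto
  then have "\<omega> (A - B) = 0"
    using assms measure_Compl cases01[of "A - B"] by auto
  moreover have "\<omega> A = \<omega> (A \<inter> B) + \<omega> (A - B)"
    using additive[of "A \<inter> B" "A - B"] by (simp add: Int_Diff_Un Int_Diff_disjoint)
  ultimately show ?thesis using assms by simp
qed

text \<open>Recasting the sets of measure one as a filter makes the general theory of
  \<open>eventually\<close>, \<open>tendsto\<close> and \<open>limitin\<close> available for limits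
  along \<omega>.\<close>

definition uf :: "nat filter" where
  "uf = Abs_filter (\<lambda>P. \<omega> {m. P m} = 1)"

lemma eventually_uf: "eventually P uf \<longleftrightarrow> \<omega> {m. P m} = 1"
  unfolding uf_def
proof (rule eventually_Abs_filter)
  show "is_filter (\<lambda>P. \<omega> {m. P m} = 1)"
  proof
    show "\<omega> {m. True} = 1" using measure_UNIV by simp
    show "\<omega> {m. P m \<and> Q m} = 1" if "\<omega> {m. P m} = 1" "\<omega> {m. Q m} = 1" for P Q
      using measure_Int[OF that] by (simp add: Collect_conj_eq)
    show "\<omega> {m. Q m} = 1" if "\<forall>m. P m \<longrightarrow> Q m" "\<omega> {m. P m} = 1" for P Q
      using measure_mono[of "{m. P m}" "{m. Q m}"] that cases01[of "{m. Q m}"]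
      by (auto simp: Collect_mono)
  qed
qed

lemma uf_neq_bot [simp]: "uf \<noteq> bot"
  using measure_empty by (simp add: trivial_limit_def eventually_uf)

text \<open>Here the two values of \<omega> enter: they make the filter maximal, and the compactness
  argument below rests on this.\<close>

lemma uf_dichotomy: "eventually P uf \<or> eventually (\<lambda>m. \<not> P m) uf"
  using measure_Compl[of "{m. P m}"] cases01[of "{m. P m}"]
  by (auto simp: eventually_uf Collect_neg_eq)

lemma ultra_lim_eqI:
  assumes "(a \<longlongrightarrow> l) uf" shows "ultra_lim \<omega> a = l"
  unfolding ultra_lim_def
proof (rule the_equality)
  show "\<forall>U. open U \<and> l \<in> U \<longrightarrow> \<omega> {m. a m \<in> U} = 1"
    using assms by (auto simp: tendsto_def eventually_uf)
  fix k assume "\<forall>U. open U \<and> k \<in> U \<longrightarrow> \<omega> {m. a m \<in> U} = 1"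
  then have "(a \<longlongrightarrow> k) uf"
    by (auto simp: tendsto_def eventually_uf)
  then show "k = l" using assms tendsto_unique uf_neq_bot by blast
qed

text \<open>Otherwise \<open>uf_dichotomy\<close> gives every point of \<open>K\<close> an open
  neighbourhood that \<open>x m\<close> avoids for almost every \<open>m\<close>; a finite subcover
  then yields an index with \<open>x m\<close> outside \<open>K\<close>. The general topology covers
  both real intervals and balls in proper spaces.\<close>

lemma compactin_imp_limitin:
  assumes K: "compactin X K" and x: "range x \<subseteq> K"
  shows "\<exists>l\<in>K. limitin X x l uf"
proof (rule ccontr)
  assume no: "\<not> ?thesis"
  have KX: "K \<subseteq> topspace X" using K compactin_subset_topspace by blast
  define \<U> where "\<U> = {U. openin X U \<and> eventually (\<lambda>m. x m \<notin> U) uf}"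
  have "\<exists>U\<in>\<U>. l \<in> U" if "l \<in> K" for l
    using no that KX uf_dichotomy unfolding limitin_def \<U>_def by blast
  then have "K \<subseteq> \<Union>\<U>" by blast
  then have "\<exists>\<F>. finite \<F> \<and> \<F> \<subseteq> \<U> \<and> K \<subseteq> \<Union>\<F>"
    by (intro compactinD[OF K]) (auto simp: \<U>_def)
  then obtain \<F> where \<F>: "finite \<F>" "\<F> \<subseteq> \<U>" "K \<subseteq> \<Union>\<F>"
    by blast
  have "\<forall>U\<in>\<F>. eventually (\<lambda>m. x m \<notin> U) uf"
    using \<F>(2) unfolding \<U>_def by blast
  then have "eventually (\<lambda>m. \<forall>U\<in>\<F>. x m \<notin> U) uf"
    by (rule eventually_ball_finite[OF \<F>(1)])
  from eventually_happens'[OF uf_neq_bot this]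
  obtain m where "\<forall>U\<in>\<F>. x m \<notin> U" ..
  moreover have "x m \<in> \<Union>\<F>" using \<F>(3) x by (meson rangeI subsetD)
  ultimately show False by blast
qed

text \<open>Compactness of \<open>{-B..B}\<close> supplies a limit, so the definite description in
  \<open>ultra_lim\<close> denotes it for every bounded sequence.\<close>

lemma tendsto_ultra_lim:
  assumes "\<And>m. \<bar>a m\<bar> \<le> B" shows "(a \<longlongrightarrow> ultra_lim \<omega> a) uf"
proof -
  have "a m \<in> {-B..B}" for m using assms[of m] by auto
  then have "range a \<subseteq> {-B..B}" by blast
  then obtain l where "(a \<longlongrightarrow> l) uf"
    using compactin_imp_limitin[of euclidean "{-B..B}" a] by auto
  then show ?thesis using ultra_lim_eqI by simp
qed

end


section \<open>The ultra-completion as a metric space\<close>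

locale ultra_metric_space = ultrafilter_nat \<omega> + Metric_space M d
  for \<omega> :: "nat set \<Rightarrow> real" and M :: "'a set" and d :: "'a \<Rightarrow> 'a \<Rightarrow> real"
begin

section \<open>Pseudo-distance on bounded sequences\<close>

abbreviation S :: "(nat \<Rightarrow> 'a) set" where "S \<equiv> ultra_seqs M d"

abbreviation R :: "((nat \<Rightarrow> 'a) \<times> (nat \<Rightarrow> 'a)) set" where "R \<equiv> ultra_rel \<omega> M d"

abbreviation \<rho> :: "(nat \<Rightarrow> 'a) \<Rightarrow> (nat \<Rightarrow> 'a) \<Rightarrow> real" where
  "\<rho> x y \<equiv> ultra_lim \<omega> (\<lambda>m. d (x m) (y m))"

lemma ultra_seqs_mem: "x \<in> S \<Longrightarrow> x m \<in> M"
  by (auto simp: ultra_seqs_def)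

lemma ultra_seqs_const: "p \<in> M \<Longrightarrow> (\<lambda>_. p) \<in> S"
  by (auto simp: ultra_seqs_def)

lemma ultra_seqs_bound:
  "x \<in> S \<Longrightarrow> \<exists>B. \<forall>m. d (x 0) (x m) \<le> B"
  by (auto simp: ultra_seqs_def bdd_above_def)

text \<open>A detour through \<open>x 0\<close> and \<open>y 0\<close> bounds the distances, so
  their limit exists and the ordinary limit laws apply to \<open>\<rho>\<close>.\<close>

lemma tendsto_\<rho>:
  assumes x: "x \<in> S" and y: "y \<in> S"
  shows "((\<lambda>m. d (x m) (y m)) \<longlongrightarrow> \<rho> x y) uf"
proof -
  obtain A B where A: "\<And>m. d (x 0) (x m) \<le> A" and B: "\<And>m. d (y 0) (y m) \<le> B"
    using ultra_seqs_bound[OF x] ultra_seqs_bound[OF y] by blast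
  have "\<bar>d (x m) (y m)\<bar> \<le> A + d (x 0) (y 0) + B" for m
  proof -
    have "d (x m) (y m) \<le> d (x m) (x 0) + d (x 0) (y m)" "d (x 0) (y m) \<le> d (x 0) (y 0) + d (y 0) (y m)"
      by (rule triangle; simp add: x y ultra_seqs_mem)+
    then show ?thesis using A[of m] B[of m] commute[of "x m" "x 0"] by simp
  qed
  then show ?thesis by (rule tendsto_ultra_lim)
qed

lemma \<rho>_nonneg: "x \<in> S \<Longrightarrow> y \<in> S \<Longrightarrow> 0 \<le> \<rho> x y"
  using tendsto_lowerbound[OF tendsto_\<rho>, of x y 0] by simp

lemma \<rho>_commute: "\<rho> x y = \<rho> y x"
  by (simp add: commute)

lemma \<rho>_triangle:
  assumes "x \<in> S" "y \<in> S" "z \<in> S" shows "\<rho> x z \<le> \<rho> x y + \<rho> y z"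
proof (rule tendsto_le[OF uf_neq_bot])
  show "((\<lambda>m. d (x m) (y m) + d (y m) (z m)) \<longlongrightarrow> \<rho> x y + \<rho> y z) uf"
    using assms by (intro tendsto_add tendsto_\<rho>)
  show "((\<lambda>m. d (x m) (z m)) \<longlongrightarrow> \<rho> x z) uf"
    using assms by (intro tendsto_\<rho>)
  show "\<forall>\<^sub>F m in uf. d (x m) (z m) \<le> d (x m) (y m) + d (y m) (z m)"
    using assms by (intro always_eventually allI triangle) (auto simp: ultra_seqs_mem)
qed

lemma \<rho>_const: "p \<in> M \<Longrightarrow> q \<in> M \<Longrightarrow> \<rho> (\<lambda>_. p) (\<lambda>_. q) = d p q"
  by (rule ultra_lim_eqI) simp

lemma ultra_rel_iff: "(x, y) \<in> R \<longleftrightarrow> x \<in> S \<and> y \<in> S \<and> \<rho> x y = 0"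
  by (simp add: ultra_rel_def)

section \<open>Equivalence classes of sequences\<close>

lemma equiv_ultra_rel: "equiv S R"
proof (rule equivI)
  show "R \<subseteq> S \<times> S" by (auto simp: ultra_rel_def)
  show "refl_on S R"
    by (rule refl_onI) (auto simp: ultra_rel_iff ultra_seqs_mem intro!: ultra_lim_eqI)
  show "sym R" 
  proof (rule symI)
    fix x y assume "(x, y) \<in> R"
    then show "(y, x) \<in> R" unfolding ultra_rel_iff \<rho>_commute[of y x] by blast
  qed
  show "trans R"
  proof (rule transI)
    fix x y z assume "(x, y) \<in> R" "(y, z) \<in> R"
    then show "(x, z) \<in> R"
      using \<rho>_triangle[of x y z] \<rho>_nonneg[of x z] unfolding ultra_rel_iff by linarith
  qed
qed

text \<open>Replacing a sequence by an equivalent one costs nothing in the triangle inequality. This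
  makes the definite description in \<open>ultra_dist\<close> meaningful on classes.\<close>

lemma \<rho>_cong:
  assumes "(x, x') \<in> R" "(y, y') \<in> R" shows "\<rho> x y = \<rho> x' y'"
proof -
  have le: "\<rho> a b \<le> \<rho> a' b'" if "(a, a') \<in> R" "(b, b') \<in> R" for a b a' b'
    using that \<rho>_triangle[of a a' b] \<rho>_triangle[of a' b' b] \<rho>_commute[of b b']
    unfolding ultra_rel_iff by linarith
  have "sym R" using equiv_ultra_rel by (simp add: equiv_def)
  then have sym: "(x', x) \<in> R" "(y', y) \<in> R" using assms by (blast dest: symD)+
  show ?thesis by (rule antisym[OF le[OF assms] le[OF sym]])
qed

lemma completion_cases:
  assumes "A \<in> ultra_completion \<omega> M d"
  obtains x where "x \<in> S" "A = R `` {x}"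
  using assms by (auto simp: ultra_completion_def quotient_def)

lemma ultra_dist_class:
  assumes "x \<in> S" "y \<in> S" shows "ultra_dist \<omega> d (R `` {x}) (R `` {y}) = \<rho> x y"
  unfolding ultra_dist_def
proof (rule the_equality)
  show "\<forall>x'\<in>R `` {x}. \<forall>y'\<in>R `` {y}. \<rho> x y = \<rho> x' y'"
    using \<rho>_cong by blast
  have "x \<in> R `` {x}" "y \<in> R `` {y}"
    using assms equiv_class_self[OF equiv_ultra_rel] by auto
  then show "r = \<rho> x y" if "\<forall>x'\<in>R `` {x}. \<forall>y'\<in>R `` {y}. r = \<rho> x' y'" for r
    using that by blast
qed

text \<open>Equivalent sequences have \<open>\<rho>\<close> zero, so the Lipschitz bound forces
  \<open>Q\<close> to agree on them and \<open>Q\<close> descends to the quotient. It then suffices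
  to select one point for each bounded sequence.\<close>

lemma retraction_from_seqs:
  assumes mem: "\<And>x. x \<in> S \<Longrightarrow> Q x \<in> M"
    and lip: "\<And>x y. x \<in> S \<Longrightarrow> y \<in> S \<Longrightarrow> d (Q x) (Q y) \<le> \<rho> x y"
    and const: "\<And>p. p \<in> M \<Longrightarrow> Q (\<lambda>_. p) = p"
  shows "\<exists>P. one_lipschitz (ultra_completion \<omega> M d) (ultra_dist \<omega> d) M d P \<and>
             (\<forall>x\<in>M. P (ultra_incl \<omega> M d x) = x)"
proof (intro exI conjI ballI)
  let ?P = "\<lambda>A. Q (SOME x. x \<in> A)"
  have on_class: "?P (R `` {x}) = Q x" if "x \<in> S" for x
  proof -
    have "(SOME y. y \<in> R `` {x}) \<in> R `` {x}"
      using equiv_class_self[OF equiv_ultra_rel that] by (rule someI[of "\<lambda>y. y \<in> R `` {x}"])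
    then have y: "(SOME y. y \<in> R `` {x}) \<in> S" "\<rho> x (SOME y. y \<in> R `` {x}) = 0"
      by (auto simp: ultra_rel_iff)
    then have "d (Q x) (?P (R `` {x})) \<le> 0"
      using lip[OF that y(1)] by simp
    then have "d (Q x) (?P (R `` {x})) = 0"
      by (simp add: antisym)
    then show ?thesis
      using zero mem that y by metis
  qed
  show "one_lipschitz (ultra_completion \<omega> M d) (ultra_dist \<omega> d) M d ?P"
    by (auto simp: one_lipschitz_def on_class mem lip ultra_dist_class
        simp del: Image_singleton_iff elim!: completion_cases)
  show "?P (ultra_incl \<omega> M d p) = p" if "p \<in> M" for p
    using on_class[OF ultra_seqs_const[OF that]] const[OF that] by (simp add: ultra_incl_def)
qed

text \<open>\<open>Metric_space\<close> demands nonnegativity and symmetry for all arguments of the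
  type, while \<open>ultra_dist\<close> is controlled only on the completion; hence the value 0
  elsewhere.\<close>

definition completion_dist :: "(nat \<Rightarrow> 'a) set \<Rightarrow> (nat \<Rightarrow> 'a) set \<Rightarrow> real" where
  "completion_dist A B = (if A \<in> ultra_completion \<omega> M d \<and> B \<in> ultra_completion \<omega> M d
     then ultra_dist \<omega> d A B else 0)"

lemma class_in_completion: "x \<in> S \<Longrightarrow> R `` {x} \<in> ultra_completion \<omega> M d"
  by (simp add: ultra_completion_def quotientI)

lemma completion_dist_class:
  "x \<in> S \<Longrightarrow> y \<in> S \<Longrightarrow> completion_dist (R `` {x}) (R `` {y}) = \<rho> x y"
  by (simp add: completion_dist_def class_in_completion ultra_dist_class)

lemma Metric_space_completion: "Metric_space (ultra_completion \<omega> M d) completion_dist"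
proof
  note [simp] = completion_dist_class
  show "0 \<le> completion_dist A B" for A B
    by (cases "A \<in> ultra_completion \<omega> M d \<and> B \<in> ultra_completion \<omega> M d")
      (auto simp: \<rho>_nonneg elim!: completion_cases, auto simp: completion_dist_def)
  show "completion_dist A B = completion_dist B A" for A B
    by (cases "A \<in> ultra_completion \<omega> M d \<and> B \<in> ultra_completion \<omega> M d")
      (auto intro: \<rho>_commute elim!: completion_cases, auto simp: completion_dist_def)
  show "completion_dist A B = 0 \<longleftrightarrow> A = B"
    if AB: "A \<in> ultra_completion \<omega> M d" "B \<in> ultra_completion \<omega> M d" for A B
  proof -
    obtain x where "x \<in> S" "A = R `` {x}" by (rule completion_cases[OF AB(1)])
    moreover obtain y where "y \<in> S" "B = R `` {y}" by (rule completion_cases[OF AB(2)])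
    ultimately show ?thesis
      using eq_equiv_class_iff[OF equiv_ultra_rel, of x y] ultra_rel_iff[of x y] by simp
  qed
  show "completion_dist A C \<le> completion_dist A B + completion_dist B C"
    if "A \<in> ultra_completion \<omega> M d" "B \<in> ultra_completion \<omega> M d" "C \<in> ultra_completion \<omega> M d" for A B C
    using that by (auto simp: \<rho>_triangle elim!: completion_cases)
qed

lemma isometric_embedding_incl:
  "isometric_embedding M d (ultra_completion \<omega> M d) completion_dist (ultra_incl \<omega> M d)"
  by (auto simp: isometric_embedding_def ultra_incl_def class_in_completion
      completion_dist_class ultra_seqs_const \<rho>_const)

text \<open>By the triangle inequality \<open>d p q\<close> exceeds \<open>d (x m) (y m)\<close> by
  at most the distances of \<open>x m\<close> to \<open>p\<close> and of \<open>y m\<close> to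
  \<open>q\<close>, each below half of \<epsilon> for almost every \<open>m\<close>.\<close>

lemma limitin_dist_le:
  assumes x: "x \<in> S" and y: "y \<in> S"
    and p: "limitin mtopology x p uf" and q: "limitin mtopology y q uf"
  shows "d p q \<le> \<rho> x y"
proof -
  have M: "p \<in> M" "q \<in> M" using p q limitin_mspace by auto
  show ?thesis
  proof (rule field_le_epsilon)
    fix \<epsilon> :: real assume "0 < \<epsilon>"
    then have "\<forall>\<^sub>F m in uf. d (x m) p < \<epsilon> / 2" "\<forall>\<^sub>F m in uf. d (y m) q < \<epsilon> / 2"
      using p q unfolding limitin_metric
      by (smt (verit, best) eventually_mono half_gt_zero)+
    then have "\<forall>\<^sub>F m in uf. d p q - \<epsilon> \<le> d (x m) (y m)"
    proof eventually_elim
      case (elim m)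
      have "d p q \<le> d p (x m) + d (x m) q" "d (x m) q \<le> d (x m) (y m) + d (y m) q"
        using M x y ultra_seqs_mem by (auto intro: triangle)
      then show ?case using elim commute[of p "x m"] by linarith
    qed
    then have "d p q - \<epsilon> \<le> \<rho> x y"
      using tendsto_lowerbound[OF tendsto_\<rho>[OF x y]] by simp
    then show "d p q \<le> \<rho> x y + \<epsilon>" by simp
  qed
qed

end

lemma one_complemented_in_ultra_completionsI:
  assumes "Metric_space M d"
    and "\<And>\<omega>. ultra_metric_space \<omega> M d \<Longrightarrow>
      \<exists>P. one_lipschitz (ultra_completion \<omega> M d) (ultra_dist \<omega> d) M d P \<and>
          (\<forall>x\<in>M. P (ultra_incl \<omega> M d x) = x)"
  shows "one_complemented_in_ultra_completions M d"
  using assms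
  by (simp add: one_complemented_in_ultra_completions_def ultra_metric_space_def ultrafilter_nat_def)


section \<open>Proper and injective spaces\<close>

text \<open>A bounded sequence stays in a closed ball around its first term; this ball is compact,
  so the sequence converges along the ultrafilter.\<close>

lemma proper_one_complemented:
  assumes proper: "proper_metric_space M d"
  shows "one_complemented_in_ultra_completions M d"
proof (rule one_complemented_in_ultra_completionsI)
  show "Metric_space M d" using proper by (simp add: proper_metric_space_def)
  fix \<omega> assume "ultra_metric_space \<omega> M d"
  then interpret ultra_metric_space \<omega> M d .
  have "\<exists>p. limitin mtopology x p uf" if x: "x \<in> S" for x
  proof -
    obtain B where B: "\<And>m. d (x 0) (x m) \<le> B"
      using ultra_seqs_bound[OF x] by blast
    have "closedin mtopology (mcball (x 0) B)" "mbounded (mcball (x 0) B)"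
      by (simp_all add: mbounded_mcball)
    then have "compactin mtopology (mcball (x 0) B)"
      using proper by (simp add: proper_metric_space_def)
    moreover have "range x \<subseteq> mcball (x 0) B"
      using x B ultra_seqs_mem by auto
    ultimately show ?thesis using compactin_imp_limitin by blast
  qed
  then obtain Q where Q: "\<And>x. x \<in> S \<Longrightarrow> limitin mtopology x (Q x) uf" by metis
  have "Q (\<lambda>_. p) = p" if "p \<in> M" for p
  proof -
    have "limitin mtopology (\<lambda>_. p) p uf" using that by (simp add: limitin_const)
    then show ?thesis
      using limitin_metric_unique[OF Q[OF ultra_seqs_const[OF that]] _ uf_neq_bot] by blast
  qed
  with limitin_mspace[OF Q] limitin_dist_le[OF _ _ Q Q]
  show "\<exists>P. one_lipschitz (ultra_completion \<omega> M d) (ultra_dist \<omega> d) M d P \<and>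
                 (\<forall>x\<in>M. P (ultra_incl \<omega> M d x) = x)"
    by (rule retraction_from_seqs[of Q])
qed

text \<open>The ambient type in \<open>injective_metric_space\<close> is exactly the type of the
  classes, so injectivity applies to the completion itself, where \<open>completion_dist\<close> and
  \<open>ultra_dist\<close> agree.\<close>

lemma injective_one_complemented:
  assumes inj: "injective_metric_space M d"
  shows "one_complemented_in_ultra_completions M d"
proof (rule one_complemented_in_ultra_completionsI)
  show "Metric_space M d" using inj by (simp add: injective_metric_space_def injective_wrt_def)
  fix \<omega> assume "ultra_metric_space \<omega> M d"
  then interpret ultra_metric_space \<omega> M d .
  obtain P where P: "one_lipschitz (ultra_completion \<omega> M d) completion_dist M d P"
      "\<forall>x\<in>M. P (ultra_incl \<omega> M d x) = x"
    using inj Metric_space_completion isometric_embedding_incl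
    unfolding injective_metric_space_def injective_wrt_def by blast
  then have "one_lipschitz (ultra_completion \<omega> M d) (ultra_dist \<omega> d) M d P"
    by (simp add: one_lipschitz_def completion_dist_def)
  with P(2) show "\<exists>P. one_lipschitz (ultra_completion \<omega> M d) (ultra_dist \<omega> d) M d P \<and>
                 (\<forall>x\<in>M. P (ultra_incl \<omega> M d x) = x)"
    by blast
qed


section \<open>Hadamard spaces\<close>

lemma comparison_triangle:
  fixes a b c :: real
  assumes "0 \<le> a" "0 \<le> b" "0 \<le> c" "a \<le> b + c" "b \<le> a + c" "c \<le> a + b"
  obtains p q r :: "real^2" where "dist p q = a" "dist p r = b" "dist q r = c"
proof (cases "a = 0")
  case True
  then have "b = c" using assms by simp
  then show ?thesis
    using that[of 0 0 "vector [b, 0]"] True assms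
    by (simp add: dist_norm norm_vec_def L2_set_def sum_2)
next
  case False
  then have a: "a > 0" using assms by simp
  \<comment> \<open>With \<open>p\<close> at the origin and \<open>q\<close> on the first axis, the
    law of cosines gives \<open>u\<close> as the first coordinate of \<open>r\<close>. The division
    by \<open>a\<close> is why \<open>a = 0\<close> was split off.\<close>
  define u where "u = (a\<^sup>2 + b\<^sup>2 - c\<^sup>2) / (2 * a)"
  have u: "2 * a * u = a\<^sup>2 + b\<^sup>2 - c\<^sup>2" using a by (simp add: u_def)
  \<comment> \<open>Both bounds on \<open>u\<close> are squared triangle inequalities; they make the
    radicand of \<open>v\<close> nonnegative.\<close>
  have "\<bar>2 * a * u\<bar> \<le> 2 * a * b"
  proof -
    have "c\<^sup>2 \<le> (a + b)\<^sup>2" using assms by (intro power_mono) auto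
    moreover have "(a - b)\<^sup>2 \<le> c\<^sup>2"
      using assms by (intro abs_le_square_iff[THEN iffD1]) auto
    ultimately show ?thesis unfolding u by (auto simp: power2_eq_square algebra_simps abs_le_iff)
  qed
  then have "\<bar>u\<bar> \<le> b" using a by (simp add: abs_mult)
  then have ub: "u\<^sup>2 \<le> b\<^sup>2" using assms by (simp add: abs_le_square_iff[symmetric])
  define v where "v = sqrt (b\<^sup>2 - u\<^sup>2)"
  have v: "v\<^sup>2 = b\<^sup>2 - u\<^sup>2" using ub by (simp add: v_def)
  have "(a - u)\<^sup>2 + v\<^sup>2 = c\<^sup>2"
    using u v by (simp add: power2_eq_square algebra_simps)
  then show ?thesis
    using that[of 0 "vector [a, 0]" "vector [u, v]"] v assms
    by (simp add: dist_norm norm_vec_def L2_set_def sum_2)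
qed

text \<open>Stewart's theorem, valid in every inner product space; it evaluates the comparison
  distance exactly.\<close>

lemma dist_segment_squared:
  fixes p q r :: "'v::real_inner"
  shows "(dist (p + t *\<^sub>R (q - p)) r)\<^sup>2 = (1 - t) * (dist p r)\<^sup>2 + t * (dist q r)\<^sup>2 - t * (1 - t) * (dist p q)\<^sup>2"
  by (simp add: dist_norm power2_norm_eq_inner inner_commute algebra_simps)

text \<open>This is the Bruhat-Tits inequality at ratio \<open>t\<close>: comparison bounds the
  distance by a Euclidean one, which Stewart's theorem computes. That \<open>c\<close> is chosen
  before \<open>z\<close> later allows limits over \<open>z\<close>.\<close>

lemma CAT0_point_on_segment:
  assumes cat: "CAT0_space M d" and M: "p \<in> M" "q \<in> M" and t: "0 \<le> t" "t \<le> 1"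
  obtains c where "c \<in> M"
    "\<And>z. z \<in> M \<Longrightarrow> (d c z)\<^sup>2 \<le> (1 - t) * (d p z)\<^sup>2 + t * (d q z)\<^sup>2 - t * (1 - t) * (d p q)\<^sup>2"
proof -
  interpret Metric_space M d using cat by (simp add: CAT0_space_def)
  obtain g where g: "geodesic M d p q g" using cat M unfolding CAT0_space_def by blast
  have s: "t * d p q \<in> {0..d p q}" using t by (simp add: mult_left_le_one_le)
  show thesis
  proof
    show "g (t * d p q) \<in> M" using g s by (auto simp: geodesic_def)
    fix z assume z: "z \<in> M"
    obtain h where h: "geodesic M d p z h" using cat M z unfolding CAT0_space_def by blast
    obtain p' q' r' :: "real^2" where
      cmp: "dist p' q' = d p q" "dist p' r' = d p z" "dist q' r' = d q z"
      using comparison_triangle[of "d p q" "d p z" "d q z"] triangle M z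
      by (metis commute nonneg)
    let ?x = "p' + t *\<^sub>R (q' - p')"
    have x: "?x \<in> closed_segment p' q'"
      using t by (auto simp: closed_segment_def algebra_simps intro!: exI[of _ t])
    have dx: "dist p' ?x = t * d p q"
      using t cmp by (simp add: dist_norm norm_minus_commute)
    \<comment> \<open>The second comparison point is the vertex \<open>r'\<close> itself, the end of
      the side that compares with \<open>h\<close>.\<close>
    have "d (g (t * d p q)) (h (d p z)) \<le> dist ?x r'"
      using cat M z g h cmp s x dx unfolding CAT0_space_def
      by (smt (verit, ccfv_threshold) atLeastAtMost_iff ends_in_segment(2) nonneg)
    moreover have "h (d p z) = z" using h by (simp add: geodesic_def)
    ultimately have "(d (g (t * d p q)) z)\<^sup>2 \<le> (dist ?x r')\<^sup>2"
      by (simp add: power_mono)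
    then show "(d (g (t * d p q)) z)\<^sup>2 \<le> (1 - t) * (d p z)\<^sup>2 + t * (d q z)\<^sup>2 - t * (1 - t) * (d p q)\<^sup>2"
      unfolding dist_segment_squared cmp .
  qed
qed

text \<open>Cauchy-Schwarz with weights \<open>t\<close> and \<open>1 - t\<close>; the defect is a
  square divided by \<open>t * (1 - t)\<close>.\<close>

lemma weighted_square_sum:
  fixes a b t :: real
  assumes "0 < t" "t < 1" shows "(a + b)\<^sup>2 \<le> a\<^sup>2 / t + b\<^sup>2 / (1 - t)"
proof -
  have "a\<^sup>2 / t + b\<^sup>2 / (1 - t) - (a + b)\<^sup>2 = ((1 - t) * a - t * b)\<^sup>2 / (t * (1 - t))"
    using assms by (simp add: field_simps power2_eq_square)
  also have "\<dots> \<ge> 0" using assms by simp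
  finally show ?thesis by simp
qed

text \<open>The optimal \<open>r\<close> is \<open>v / u\<close>, which is not a positive number
  when \<open>u\<close> or \<open>v\<close> vanishes. Hence both are enlarged by \<epsilon>, which
  then tends to 0.\<close>

lemma AM_GM_scaled:
  fixes A u v :: real
  assumes le: "\<And>r. 0 < r \<Longrightarrow> A \<le> r * u\<^sup>2 + v\<^sup>2 / r" and nonneg: "0 \<le> u" "0 \<le> v"
  shows "A \<le> 2 * u * v"
proof (rule tendsto_lowerbound)
  let ?f = "\<lambda>\<epsilon>. 2 * (u + \<epsilon>) * (v + \<epsilon>) :: real"
  show "(?f \<longlongrightarrow> 2 * u * v) (at_right 0)"
    by (auto intro!: tendsto_eq_intros)
  have "A \<le> ?f \<epsilon>" if "\<epsilon> > 0" for \<epsilon>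
  proof -
    have pos: "u + \<epsilon> > 0" "v + \<epsilon> > 0" using that nonneg by auto
    have "A \<le> (v + \<epsilon>) / (u + \<epsilon>) * u\<^sup>2 + v\<^sup>2 / ((v + \<epsilon>) / (u + \<epsilon>))"
      using pos by (intro le) simp
    also have "\<dots> \<le> (v + \<epsilon>) / (u + \<epsilon>) * (u + \<epsilon>)\<^sup>2 + (v + \<epsilon>)\<^sup>2 / ((v + \<epsilon>) / (u + \<epsilon>))"
      using pos nonneg that by (intro add_mono mult_left_mono divide_right_mono power_mono) auto
    also have "\<dots> = ?f \<epsilon>"
    proof -
      have "V / U * U\<^sup>2 + V\<^sup>2 / (V / U) = 2 * U * V" if "0 < U" "0 < V" for U V :: real
        using that by (simp add: field_simps power2_eq_square)
      then show ?thesis using pos .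
    qed
    finally show ?thesis .
  qed
  then show "\<forall>\<^sub>F \<epsilon> in at_right 0. A \<le> ?f \<epsilon>"
    by (auto simp: eventually_at_right_less eventually_at_filter)
qed auto

text \<open>
  Estimate \<open>d y b\<close> through the point \<open>c\<close> at ratio \<open>t\<close> of the diagonal from \<open>x\<close> to \<open>b'\<close>. Weighting the
  two halves by \<open>1 / t\<close> and \<open>1 / (1 - t)\<close> gives the coefficient 1 to the squared sides \<open>d x b\<close> and
  \<open>d y b'\<close>, and the remaining terms are optimized over \<open>t\<close>.
\<close>

lemma CAT0_quadrilateral:
  assumes cat: "CAT0_space M d" and M: "x \<in> M" "y \<in> M" "b \<in> M" "b' \<in> M"
  shows "(d x b')\<^sup>2 + (d y b)\<^sup>2 \<le> (d x b)\<^sup>2 + (d y b')\<^sup>2 + 2 * d x y * d b b'"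
proof -
  interpret Metric_space M d using cat by (simp add: CAT0_space_def)
  let ?A = "(d x b')\<^sup>2 + (d y b)\<^sup>2 - (d x b)\<^sup>2 - (d y b')\<^sup>2"
  have "?A \<le> 2 * d x y * d b b'"
  proof (rule AM_GM_scaled)
    fix r :: real assume r: "0 < r"
    \<comment> \<open>Solving \<open>(1 - t) / t = r\<close> for \<open>t\<close> produces the
      weights \<open>r\<close> and \<open>1 / r\<close> that \<open>AM_GM_scaled\<close> asks
      for.\<close>
    define t where "t = 1 / (1 + r)"
    have t: "0 < t" "t < 1" "(1 - t) / t = r" "t / (1 - t) = 1 / r"
      using r by (auto simp: t_def field_simps)
    obtain c where c: "c \<in> M" and
      cz: "\<And>z. z \<in> M \<Longrightarrow> (d c z)\<^sup>2 \<le> (1 - t) * (d x z)\<^sup>2 + t * (d b' z)\<^sup>2 - t * (1 - t) * (d x b')\<^sup>2"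
      using CAT0_point_on_segment[OF cat M(1,4)] t by (metis less_imp_le)
    have "(d y b)\<^sup>2 \<le> (d c y + d c b)\<^sup>2"
      using triangle[of y c b] M c commute[of y c] by (intro power_mono) auto
    also have "\<dots> \<le> (d c y)\<^sup>2 / t + (d c b)\<^sup>2 / (1 - t)"
      using t by (intro weighted_square_sum)
    also have "\<dots> \<le> ((1 - t) * (d x y)\<^sup>2 + t * (d b' y)\<^sup>2 - t * (1 - t) * (d x b')\<^sup>2) / t
        + ((1 - t) * (d x b)\<^sup>2 + t * (d b' b)\<^sup>2 - t * (1 - t) * (d x b')\<^sup>2) / (1 - t)"
      using t cz M by (intro add_mono divide_right_mono) auto
    also have "\<dots> = ((1 - t) / t) * (d x y)\<^sup>2 + (d b' y)\<^sup>2 + (d x b)\<^sup>2 + (t / (1 - t)) * (d b' b)\<^sup>2 - (d x b')\<^sup>2"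
    proof -
      have eqs: "((1 - t) * X + t * Y - t * (1 - t) * Z) / t = (1 - t) / t * X + Y - (1 - t) * Z"
        "((1 - t) * X + t * Y - t * (1 - t) * Z) / (1 - t) = X + t / (1 - t) * Y - t * Z" for X Y Z
        using t(1,2) by (simp_all add: field_simps)
      \<comment> \<open>The diagonal occurs once with factor \<open>1 - t\<close> and once with
        factor \<open>t\<close>, hence in total with factor 1.\<close>
      have "(1 - t) * (d x b')\<^sup>2 = (d x b')\<^sup>2 - t * (d x b')\<^sup>2"
        by (simp add: left_diff_distrib)
      then show ?thesis unfolding eqs by linarith
    qed
    finally show "?A \<le> r * (d x y)\<^sup>2 + (d b b')\<^sup>2 / r"
      unfolding t by (simp add: commute[of b' y] commute[of b' b])
  qed auto
  then show ?thesis by simp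
qed

section \<open>Barycenters of bounded sequences\<close>

locale ultra_Hadamard = ultra_metric_space +
  assumes CAT0: "CAT0_space M d" and complete: mcomplete
begin

text \<open>One point \<open>c\<close> serves all \<open>x m\<close> simultaneously, so the
  inequality for squared distances passes to the limit term by term.\<close>

lemma \<rho>_segment:
  assumes x: "x \<in> S" and M: "p \<in> M" "q \<in> M" and t: "0 \<le> t" "t \<le> 1"
  obtains c where "c \<in> M"
    "(\<rho> (\<lambda>_. c) x)\<^sup>2 \<le> (1 - t) * (\<rho> (\<lambda>_. p) x)\<^sup>2 + t * (\<rho> (\<lambda>_. q) x)\<^sup>2 - t * (1 - t) * (d p q)\<^sup>2"
proof -
  obtain c where c: "c \<in> M" and
    cz: "\<And>z. z \<in> M \<Longrightarrow> (d c z)\<^sup>2 \<le> (1 - t) * (d p z)\<^sup>2 + t * (d q z)\<^sup>2 - t * (1 - t) * (d p q)\<^sup>2"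
    using CAT0_point_on_segment[OF CAT0 M t] by metis
  note lim = tendsto_\<rho>[OF ultra_seqs_const x]
  show thesis
  proof
    show "(\<rho> (\<lambda>_. c) x)\<^sup>2 \<le> (1 - t) * (\<rho> (\<lambda>_. p) x)\<^sup>2 + t * (\<rho> (\<lambda>_. q) x)\<^sup>2 - t * (1 - t) * (d p q)\<^sup>2"
    proof (rule tendsto_le[OF uf_neq_bot])
      show "((\<lambda>m. (d c (x m))\<^sup>2) \<longlongrightarrow> (\<rho> (\<lambda>_. c) x)\<^sup>2) uf"
        using lim c by (intro tendsto_power)
      show "((\<lambda>m. (1 - t) * (d p (x m))\<^sup>2 + t * (d q (x m))\<^sup>2 - t * (1 - t) * (d p q)\<^sup>2) \<longlongrightarrow>
          (1 - t) * (\<rho> (\<lambda>_. p) x)\<^sup>2 + t * (\<rho> (\<lambda>_. q) x)\<^sup>2 - t * (1 - t) * (d p q)\<^sup>2) uf"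
        using lim M by (intro tendsto_intros) auto
      show "\<forall>\<^sub>F m in uf. (d c (x m))\<^sup>2 \<le>
          (1 - t) * (d p (x m))\<^sup>2 + t * (d q (x m))\<^sup>2 - t * (1 - t) * (d p q)\<^sup>2"
        using cz ultra_seqs_mem[OF x] by (intro always_eventually) auto
    qed
  qed (fact c)
qed

text \<open>Uniform convexity of the squared distance makes a minimizing sequence Cauchy;
  completeness gives a limit, and the triangle inequality for \<open>\<rho>\<close> shows that it is
  a minimizer.\<close>

lemma barycenter_exists:
  assumes x: "x \<in> S"
  shows "\<exists>b\<in>M. \<forall>z\<in>M. \<rho> (\<lambda>_. b) x \<le> \<rho> (\<lambda>_. z) x"
proof -
  define f where "f p = \<rho> (\<lambda>_. p) x" for p
  have f0: "0 \<le> f p" if "p \<in> M" for p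
    using \<rho>_nonneg ultra_seqs_const x that by (simp add: f_def)
  define I where "I = (INF p\<in>M. (f p)\<^sup>2)"
  have ne: "M \<noteq> {}" using ultra_seqs_mem[OF x] by blast
  have bdd: "bdd_below ((\<lambda>p. (f p)\<^sup>2) ` M)" by (rule bdd_belowI[of _ 0]) auto
  have I: "I \<le> (f p)\<^sup>2" if "p \<in> M" for p
    unfolding I_def using bdd that by (rule cINF_lower)
  have "\<exists>p\<in>M. (f p)\<^sup>2 < I + 1 / real (Suc n)" for n
    using cINF_less_iff[OF ne bdd, of "I + 1 / real (Suc n)"] by (simp add: I_def)
  then obtain p where p: "\<And>n. p n \<in> M" "\<And>n. (f (p n))\<^sup>2 < I + 1 / real (Suc n)" by metis
  have close: "(d (p m) (p n))\<^sup>2 \<le> 2 * (1 / real (Suc m) + 1 / real (Suc n))" for m n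
  proof -
    \<comment> \<open>The midpoint of \<open>p m\<close> and \<open>p n\<close> also has value at
      least \<open>I\<close>, which leaves little room for \<open>d (p m) (p n)\<close>.\<close>
    obtain c where "c \<in> M" "(f c)\<^sup>2 \<le> (1 - 1/2) * (f (p m))\<^sup>2 + 1/2 * (f (p n))\<^sup>2 - 1/2 * (1 - 1/2) * (d (p m) (p n))\<^sup>2"
      using \<rho>_segment[OF x p(1)[of m] p(1)[of n], of "1/2"] unfolding f_def by auto
    then have "I \<le> (f c)\<^sup>2" "(d (p m) (p n))\<^sup>2 \<le> 2 * (f (p m))\<^sup>2 + 2 * (f (p n))\<^sup>2 - 4 * (f c)\<^sup>2"
      using I by auto
    then show ?thesis using p(2)[of m] p(2)[of n] by argo
  qed
  have "MCauchy p"
    unfolding MCauchy_def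
  proof (intro conjI allI impI)
    show "range p \<subseteq> M" using p by auto
    fix \<epsilon> :: real assume \<epsilon>: "0 < \<epsilon>"
    \<comment> \<open>The divisor 4 absorbs the factor 2 in \<open>close\<close> and its two error
      terms.\<close>
    obtain N where N: "1 / real (Suc N) < \<epsilon>\<^sup>2 / 4"
      using nat_approx_posE[of "\<epsilon>\<^sup>2 / 4"] \<epsilon> by auto
    have "d (p m) (p n) < \<epsilon>" if "N \<le> m" "N \<le> n" for m n
    proof -
      have "1 / real (Suc m) \<le> 1 / real (Suc N)" "1 / real (Suc n) \<le> 1 / real (Suc N)"
        using that by (simp_all add: frac_le)
      then have "(d (p m) (p n))\<^sup>2 < \<epsilon>\<^sup>2" using close[of m n] N by argo
      then show ?thesis using \<epsilon> by (simp add: power2_less_imp_less)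
    qed
    then show "\<exists>N. \<forall>n n'. N \<le> n \<longrightarrow> N \<le> n' \<longrightarrow> d (p n) (p n') < \<epsilon>" by blast
  qed
  then obtain b where b: "limitin mtopology p b sequentially"
    using complete by (auto simp: mcomplete_def)
  then have bM: "b \<in> M" using limitin_mspace by blast
  have db: "(\<lambda>n. d (p n) b) \<longlonglongrightarrow> 0"
    using b limitin_metric_dist_null by blast
  have "\<rho> (\<lambda>_. b) x \<le> \<rho> (\<lambda>_. z) x" if z: "z \<in> M" for z
  proof -
    \<comment> \<open>Since \<open>I\<close> is at most \<open>(f z)\<^sup>2\<close>, the square
      root dominates \<open>f (p n)\<close>; the other summand pays for replacing \<open>b\<close>
      by \<open>p n\<close>.\<close>
    have lim: "(\<lambda>n. d (p n) b + sqrt ((f z)\<^sup>2 + 1 / real (Suc n))) \<longlonglongrightarrow> 0 + sqrt ((f z)\<^sup>2 + 0)"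
      by (intro tendsto_intros db LIMSEQ_Suc[OF lim_1_over_n])
    have "f b \<le> d (p n) b + sqrt ((f z)\<^sup>2 + 1 / real (Suc n))" for n
    proof -
      have "f b \<le> d b (p n) + f (p n)"
        unfolding f_def using \<rho>_triangle[of "\<lambda>_. b" "\<lambda>_. p n" x] \<rho>_const[of b "p n"]
          ultra_seqs_const bM p(1) x by auto
      moreover have "f (p n) \<le> sqrt ((f z)\<^sup>2 + 1 / real (Suc n))"
        using p(2)[of n] I[OF z] by (intro real_le_rsqrt) linarith
      ultimately show ?thesis by (simp add: commute)
    qed
    then have "f b \<le> 0 + sqrt ((f z)\<^sup>2 + 0)"
      by (intro tendsto_lowerbound[OF lim]) auto
    then show ?thesis using f0[OF z] by (simp add: f_def)
  qed
  with bM show ?thesis by blast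
qed

text \<open>Compare \<open>b\<close> with the point at ratio \<open>t\<close> between
  \<open>b\<close> and \<open>z\<close>: minimality lets a factor \<open>t\<close> cancel, and
  letting \<open>t\<close> tend to 0 leaves the full squared distance.\<close>

lemma variance_inequality:
  assumes x: "x \<in> S" and b: "b \<in> M" and min: "\<And>z. z \<in> M \<Longrightarrow> \<rho> (\<lambda>_. b) x \<le> \<rho> (\<lambda>_. z) x"
    and z: "z \<in> M"
  shows "(\<rho> (\<lambda>_. b) x)\<^sup>2 + (d b z)\<^sup>2 \<le> (\<rho> (\<lambda>_. z) x)\<^sup>2"
proof -
  let ?f = "\<lambda>p. \<rho> (\<lambda>_. p) x"
  have le: "(1 - t) * (d b z)\<^sup>2 \<le> (?f z)\<^sup>2 - (?f b)\<^sup>2" if t: "0 < t" "t \<le> 1" for t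
  proof -
    obtain c where c: "c \<in> M" "(?f c)\<^sup>2 \<le> (1 - t) * (?f b)\<^sup>2 + t * (?f z)\<^sup>2 - t * (1 - t) * (d b z)\<^sup>2"
      using \<rho>_segment[OF x b z, of t] t by auto
    have "(?f b)\<^sup>2 \<le> (?f c)\<^sup>2"
      using min[OF c(1)] \<rho>_nonneg ultra_seqs_const x b by (intro power_mono) auto
    then have "t * ((1 - t) * (d b z)\<^sup>2) \<le> t * ((?f z)\<^sup>2 - (?f b)\<^sup>2)"
      using c(2) by (simp add: algebra_simps)
    then show ?thesis using t by simp
  qed
  have "(1 - 0) * (d b z)\<^sup>2 \<le> (?f z)\<^sup>2 - (?f b)\<^sup>2"
  proof (rule tendsto_upperbound)
    show "((\<lambda>t. (1 - t) * (d b z)\<^sup>2) \<longlongrightarrow> (1 - 0) * (d b z)\<^sup>2) (at_right 0)"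
      by (intro tendsto_intros)
    show "\<forall>\<^sub>F t in at_right 0. (1 - t) * (d b z)\<^sup>2 \<le> (?f z)\<^sup>2 - (?f b)\<^sup>2"
      using le eventually_at_right_less[of 0] by (auto simp: eventually_at_right[of 0 1] intro!: exI[of _ 1])
  qed auto
  then show ?thesis by simp
qed

lemma barycenter_dist_le:
  assumes x: "x \<in> S" and y: "y \<in> S" and M: "b \<in> M" "b' \<in> M"
    and min: "\<And>z. z \<in> M \<Longrightarrow> \<rho> (\<lambda>_. b) x \<le> \<rho> (\<lambda>_. z) x"
    and min': "\<And>z. z \<in> M \<Longrightarrow> \<rho> (\<lambda>_. b') y \<le> \<rho> (\<lambda>_. z) y"
  shows "d b b' \<le> \<rho> x y"
proof -
  let ?f = "\<lambda>p x. (\<rho> (\<lambda>_. p) x)\<^sup>2"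
  have lim: "((\<lambda>m. d (z m) p) \<longlongrightarrow> \<rho> (\<lambda>_. p) z) uf" if "z \<in> S" "p \<in> M" for z p
    using tendsto_\<rho>[of z "\<lambda>_. p"] that ultra_seqs_const by (simp add: \<rho>_commute)
  have "?f b' x + ?f b y \<le> ?f b x + ?f b' y + 2 * \<rho> x y * d b b'"
  proof (rule tendsto_le[OF uf_neq_bot])
    show "((\<lambda>m. (d (x m) b')\<^sup>2 + (d (y m) b)\<^sup>2) \<longlongrightarrow> ?f b' x + ?f b y) uf"
      using x y M by (intro tendsto_intros lim)
    show "((\<lambda>m. (d (x m) b)\<^sup>2 + (d (y m) b')\<^sup>2 + 2 * d (x m) (y m) * d b b') \<longlongrightarrow>
        ?f b x + ?f b' y + 2 * \<rho> x y * d b b') uf"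
      using x y M by (intro tendsto_intros lim tendsto_\<rho>)
    show "\<forall>\<^sub>F m in uf. (d (x m) b')\<^sup>2 + (d (y m) b)\<^sup>2 \<le>
        (d (x m) b)\<^sup>2 + (d (y m) b')\<^sup>2 + 2 * d (x m) (y m) * d b b'"
      using x y M by (intro always_eventually allI CAT0_quadrilateral[OF CAT0]) (auto simp: ultra_seqs_mem)
  qed
  \<comment> \<open>Each barycenter contributes one square of \<open>d b b'\<close>. After
    cancellation, \<open>2 * (d b b')\<^sup>2 \<le> 2 * \<rho> x y * d b b'\<close> remains.\<close>
  moreover have "?f b x + (d b b')\<^sup>2 \<le> ?f b' x" "?f b' y + (d b' b)\<^sup>2 \<le> ?f b y"
    using variance_inequality x y M min min' by blast+
  ultimately have "d b b' * d b b' \<le> \<rho> x y * d b b'"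
    by (simp add: commute[of b' b] power2_eq_square)
  then show ?thesis
    using \<rho>_nonneg[OF x y] by (cases "d b b' = 0") (auto simp: mult_le_cancel_right)
qed

end

lemma Hadamard_one_complemented:
  assumes H: "Hadamard_space M d"
  shows "one_complemented_in_ultra_completions M d"
proof (rule one_complemented_in_ultra_completionsI)
  show "Metric_space M d" using H by (simp add: Hadamard_space_def CAT0_space_def)
  fix \<omega> assume "ultra_metric_space \<omega> M d"
  then interpret ultra_metric_space \<omega> M d .
  interpret ultra_Hadamard \<omega> M d
    using H by unfold_locales (auto simp: Hadamard_space_def)
  obtain Q where Q: "\<And>x. x \<in> S \<Longrightarrow> Q x \<in> M"
      "\<And>x z. x \<in> S \<Longrightarrow> z \<in> M \<Longrightarrow> \<rho> (\<lambda>_. Q x) x \<le> \<rho> (\<lambda>_. z) x"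
    using barycenter_exists by metis
  have "Q (\<lambda>_. p) = p" if p: "p \<in> M" for p
  proof -
    note pS = ultra_seqs_const[OF p]
    \<comment> \<open>For its own constant sequence \<open>p\<close> attains the value 0, so the
      minimizer must attain it as well.\<close>
    have "d (Q (\<lambda>_. p)) p \<le> 0"
      using Q(2)[OF pS p] p unfolding \<rho>_const[OF p p] \<rho>_const[OF Q(1)[OF pS] p] by simp
    then have "d (Q (\<lambda>_. p)) p = 0" by (simp add: antisym)
    then show ?thesis using zero Q(1)[OF pS] p by blast
  qed
  then show "\<exists>P. one_lipschitz (ultra_completion \<omega> M d) (ultra_dist \<omega> d) M d P \<and>
                 (\<forall>x\<in>M. P (ultra_incl \<omega> M d x) = x)"
    using Q by (intro retraction_from_seqs[of Q] barycenter_dist_le) auto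
qed


section \<open>Dual Banach spaces\<close>

text \<open>A form of the Banach-Alaoglu theorem: the pointwise limit of the functionals is again
  linear and bounded by \<open>B\<close>, and surjectivity of \<open>\<phi>\<close> represents it by
  a point.\<close>

lemma (in ultrafilter_nat) dual_limit_exists:
  fixes x :: "nat \<Rightarrow> 'x::banach" and \<phi> :: "'x \<Rightarrow> 'z::banach \<Rightarrow>\<^sub>L real"
  assumes surj: "surj \<phi>" and norm: "\<And>x. norm (\<phi> x) = norm x"
    and bound: "\<And>m. norm (x m) \<le> B"
  shows "\<exists>p. \<forall>z. ((\<lambda>m. \<phi> (x m) z) \<longlongrightarrow> \<phi> p z) uf"
proof -
  have bd: "\<bar>\<phi> (x m) z\<bar> \<le> B * norm z" for m z
    using norm_blinfun[of "\<phi> (x m)" z] norm[of "x m"] mult_right_mono[OF bound[of m], of "norm z"]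
    by simp
  define g where "g z = ultra_lim \<omega> (\<lambda>m. \<phi> (x m) z)" for z
  have g: "((\<lambda>m. \<phi> (x m) z) \<longlongrightarrow> g z) uf" for z
    unfolding g_def by (rule tendsto_ultra_lim) (rule bd)
  have "bounded_linear g"
  proof (rule bounded_linear_intro)
    fix u v :: 'z and r :: real
    show "g (u + v) = g u + g v"
      unfolding g_def[of "u + v"] using tendsto_add[OF g[of u] g[of v]]
      by (intro ultra_lim_eqI) (simp add: blinfun.add_right)
    show "g (r *\<^sub>R u) = r *\<^sub>R g u"
      unfolding g_def[of "r *\<^sub>R u"] using tendsto_scaleR[OF tendsto_const g[of u]]
      by (intro ultra_lim_eqI) (simp add: blinfun.scaleR_right)
    show "norm (g u) \<le> norm u * B"
      by (rule tendsto_upperbound[OF tendsto_norm[OF g[of u]]]) (use bd in \<open>auto simp: mult.commute\<close>)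
  qed
  moreover obtain p where "\<phi> p = Blinfun g" using surj by (metis surjD)
  ultimately have "blinfun_apply (\<phi> p) = g" by (simp add: bounded_linear_Blinfun_apply)
  with g show ?thesis by auto
qed

text \<open>The sequence is first moved by the embedding into the dual space, where its weak-star
  limit exists; the retraction, which is merely 1-Lipschitz, is applied last.\<close>

lemma one_complemented_dual_in_ultra_completions:
  assumes dual: "isometric_dual TYPE('w::banach) TYPE('z::banach)"
    and compl: "one_complemented (UNIV :: 'x::banach set) dist (UNIV :: 'w set) dist"
  shows "one_complemented_in_ultra_completions (UNIV :: 'x set) dist"
proof (rule one_complemented_in_ultra_completionsI)
  show "Metric_space (UNIV :: 'x set) dist" by (rule Met_TC.Metric_space_axioms)
  fix \<omega> assume "ultra_metric_space \<omega> (UNIV :: 'x set) dist"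
  then interpret ultra_metric_space \<omega> "UNIV :: 'x set" dist .
  obtain \<phi> :: "'w \<Rightarrow> 'z \<Rightarrow>\<^sub>L real" where
    \<phi>: "linear \<phi>" "surj \<phi>" "\<And>x. norm (\<phi> x) = norm x"
    using dual by (auto simp: isometric_dual_def)
  obtain j :: "'x \<Rightarrow> 'w" and P :: "'w \<Rightarrow> 'x" where
    j: "\<And>x y. dist (j x) (j y) = dist x y" and P: "\<And>u v. dist (P u) (P v) \<le> dist u v"
    and Pj: "\<And>x. P (j x) = x"
    using compl by (auto simp: one_complemented_def isometric_embedding_def one_lipschitz_def)
  have "\<exists>p. \<forall>z. ((\<lambda>m. \<phi> (j (x m)) z) \<longlongrightarrow> \<phi> p z) uf" if x: "x \<in> S" for x
  proof -
    obtain B where B: "\<And>m. dist (x 0) (x m) \<le> B"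
      using ultra_seqs_bound[OF x] by blast
    \<comment> \<open>An isometry \<open>j\<close> may move the origin, so norms are estimated from
      \<open>j (x 0)\<close>.\<close>
    have "norm (j (x m)) \<le> norm (j (x 0)) + B" for m
      using B[of m] j[of "x 0" "x m"] norm_triangle_sub[of "j (x m)" "j (x 0)"]
      by (simp add: dist_norm norm_minus_commute)
    then show ?thesis by (rule dual_limit_exists[OF \<phi>(2,3)])
  qed
  then obtain Q where Q: "\<And>x z. x \<in> S \<Longrightarrow> ((\<lambda>m. \<phi> (j (x m)) z) \<longlongrightarrow> \<phi> (Q x) z) uf"
    by metis
  have lip: "dist (Q x) (Q y) \<le> \<rho> x y" if x: "x \<in> S" and y: "y \<in> S" for x y
  proof -
    \<comment> \<open>Weak-star lower semicontinuity of the norm: the bound is tested at each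
      \<open>z\<close> and then passed to the limit.\<close>
    have "norm (\<phi> (Q x - Q y)) \<le> \<rho> x y"
    proof (rule norm_blinfun_bound)
      show "0 \<le> \<rho> x y" using \<rho>_nonneg x y by blast
      fix z
      show "norm (\<phi> (Q x - Q y) z) \<le> \<rho> x y * norm z"
      proof (rule tendsto_le[OF uf_neq_bot])
        show "((\<lambda>m. dist (x m) (y m) * norm z) \<longlongrightarrow> \<rho> x y * norm z) uf"
          using tendsto_\<rho>[OF x y] by (intro tendsto_intros)
        show "((\<lambda>m. norm (\<phi> (j (x m)) z - \<phi> (j (y m)) z)) \<longlongrightarrow> norm (\<phi> (Q x - Q y) z)) uf"
          using tendsto_norm[OF tendsto_diff[OF Q[OF x, of z] Q[OF y, of z]]]
          by (simp add: linear_diff[OF \<phi>(1)] blinfun.diff_left)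
        have "norm (\<phi> (j (x m)) z - \<phi> (j (y m)) z) \<le> dist (x m) (y m) * norm z" for m
          using norm_blinfun[of "\<phi> (j (x m) - j (y m))" z] \<phi>(3)[of "j (x m) - j (y m)"] j[of "x m" "y m"]
          by (simp add: linear_diff[OF \<phi>(1)] blinfun.diff_left dist_norm)
        then show "\<forall>\<^sub>F m in uf. norm (\<phi> (j (x m)) z - \<phi> (j (y m)) z) \<le> dist (x m) (y m) * norm z"
          by simp
      qed
    qed
    then show ?thesis using \<phi>(3) by (simp add: dist_norm)
  qed
  have const: "Q (\<lambda>_. p) = j p" for p
  proof -
    have "\<phi> (Q (\<lambda>_. p)) z = \<phi> (j p) z" for z
      using Q[OF ultra_seqs_const, of p z] by (simp add: tendsto_const_iff)
    then have "\<phi> (Q (\<lambda>_. p)) = \<phi> (j p)" by (rule blinfun_eqI)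
    \<comment> \<open>As a linear isometry, \<open>\<phi>\<close> is injective.\<close>
    then have "norm (Q (\<lambda>_. p) - j p) = 0"
      using \<phi>(3)[of "Q (\<lambda>_. p) - j p"] by (simp add: linear_diff[OF \<phi>(1)])
    then show ?thesis by simp
  qed
  show "\<exists>P. one_lipschitz (ultra_completion \<omega> UNIV dist) (ultra_dist \<omega> dist) UNIV dist P \<and>
            (\<forall>x\<in>UNIV. P (ultra_incl \<omega> UNIV dist x) = (x :: 'x))"
    using lip const Pj by (intro retraction_from_seqs[of "P \<circ> Q"]) (auto intro: order_trans[OF P])
qed

text \<open>Lets a dual space serve as its own ambient dual, so that the dual case becomes an
  instance of the complemented one.\<close>

lemma one_complemented_refl: "one_complemented M d M d"
  unfolding one_complemented_def isometric_embedding_def one_lipschitz_def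
  by (intro exI[of _ "\<lambda>x. x"]) auto

theorem proposition2p1:
  fixes M :: "'a set" and d :: "'a \<Rightarrow> 'a \<Rightarrow> real"
  shows
    "(proper_metric_space M d \<longrightarrow> one_complemented_in_ultra_completions M d) \<and>
     (Hadamard_space M d \<longrightarrow> one_complemented_in_ultra_completions M d) \<and>
     (injective_metric_space M d \<longrightarrow> one_complemented_in_ultra_completions M d) \<and>
     (isometric_dual TYPE('x::banach) TYPE('z::banach) \<longrightarrow>
        one_complemented_in_ultra_completions (UNIV :: 'x set) dist) \<and>
     (isometric_dual TYPE('w::banach) TYPE('z) \<and>
      one_complemented (UNIV :: 'x set) dist (UNIV :: 'w set) dist \<longrightarrow>
        one_complemented_in_ultra_completions (UNIV :: 'x set) dist)"
  using proper_one_complemented Hadamard_one_complemented injective_one_complemented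
    one_complemented_dual_in_ultra_completions[where 'x = 'x and 'w = 'x and 'z = 'z]
    one_complemented_dual_in_ultra_completions[where 'x = 'x and 'w = 'w and 'z = 'z]
    one_complemented_refl[of "UNIV :: 'x set" dist]
  by blast

end
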